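(* Let $\mathbf{K}=\{0,1\}^n$, let $d\ge1$ be an integer, $f\in\mathbb{R}[\mathbf{x}]_d$, $d_0=\deg f$, and let $\mathbf{y}\in\mathbf{K}$ with $I_1:=\{i:y_i=0\}$ and $I_2:=\{i:y_i=1\}$. Consider the inverse problem for the $\ell_1$-norm at $\mathbf{y}$: minimize $\|f'-\tilde f'\|_1$ over all $\tilde f\in\mathbb{R}[\mathbf{x}]_{d_0}$ such that $$\tilde f(\mathbf{x})-\tilde f(\mathbf{y})=\sigma_0+\sum_{i=1}^n(x_i^2-x_i)\sigma_i,\qquad \sigma_0\in\Sigma[\mathbf{x}]_d,\ \sigma_i\in\mathbb{R}[\mathbf{x}]_{2d-2},\ i=1,\dots,n,$$ where $f'(\mathbf{u}):=f(\mathbf{u}+\mathbf{y})$ and $\tilde f'(\mathbf{u}):=\tilde f(\mathbf{u}+\mathbf{y})$. Then an optimal solution $\tilde f_d\in\mathbb{R}[\mathbf{x}]_{d_0}$ of this inverse problem is of the form $$\tilde f_d(\mathbf{x})=f(\mathbf{x})+\mathbf{b}^T(\mathbf{x}-\mathbf{y})$$ for some coefficient vector $\mathbf{b}\in\mathbb{R}^n$ such that $b_i\ge0$ if $i\in I_1$ and $b_i\le0$ if $i\in I_2$, $i=1,\dots,n$ (that is, there exists an optimal solution of this form). Moreover, $\mathbf{b}$ is an optimal solution of the semidefinite program $$\begin{array}{ll}\displaystyle\min_{\mathbf{b},\sigma_0,\dots,\sigma_n}&\displaystyle\sum_{i\in I_1}b_i-\sum_{i\in I_2}b_i\ \ (=\|\mathbf{b}\|_1)\\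 \text{s.t.}&f(\mathbf{x})-f(\mathbf{y})+\mathbf{b}^T(\mathbf{x}-\mathbf{y})=\sigma_0+\displaystyle\sum_{i=1}^n(x_i^2-x_i)\,\sigma_i\\ &b_i\ge0,\ i\in I_1;\quad b_i\le0,\ i\in I_2;\quad\sigma_0\in\Sigma[\mathbf{x}]_d;\quad\sigma_i\in\mathbb{R}[\mathbf{x}]_{2d-2},\ i=1,\dots,n.\end{array}$$
   Context: $\mathbb{R}[\mathbf{x}]_t$ is the space of real polynomials in $\mathbf{x}=(x_1,\dots,x_n)$ of degree at most $t$; $\Sigma[\mathbf{x}]_d$ is the set of sums of squares of polynomials of degree at most $2d$. For a polynomial $h=\sum_\alpha h_\alpha\mathbf{u}^\alpha$, $\|h\|_1=\sum_\alpha|h_\alpha|$. The paper's standing convention is that the inverse problem at a feasible point $\mathbf{y}$ is posed in the translated coordinates $\mathbf{u}=\mathbf{x}-\mathbf{y}$ (so that $\mathbf{y}$ becomes $0$), which is why the norm is that of the coefficients in $\mathbf{u}$. The set $\{0,1\}^n$ is described by the equality constraints $x_i^2-x_i=0$, whose multipliers are arbitrary polynomials. *)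

theory Defs
  imports "HOL-Analysis.Analysis" "HOL-Library.Poly_Mapping"
begin

text \<open>Real polynomials in the variables \<open>x\<^sub>i\<close>, with \<open>i\<close> ranging over the finite
  index type \<open>'n\<close>; an exponent vector \<open>\<alpha>\<close> is mapped to the coefficient of \<open>x\<^sup>\<alpha>\<close>.\<close>

type_synonym 'n mpoly = "('n \<Rightarrow>\<^sub>0 nat) \<Rightarrow>\<^sub>0 real"

definition const_poly :: "real \<Rightarrow> 'n mpoly"
  where "const_poly c = Poly_Mapping.single 0 c"

definition var_poly :: "'n \<Rightarrow> 'n mpoly"
  where "var_poly i = Poly_Mapping.single (Poly_Mapping.single i 1) 1"

definition total_degree :: "('n::finite) mpoly \<Rightarrow> nat"
  where "total_degree p =
    Max (insert 0 ((\<lambda>\<alpha>. \<Sum>i\<in>UNIV. Poly_Mapping.lookup \<alpha> i) ` Poly_Mapping.keys p))"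
    \<comment> \<open>the zero polynomial has degree 0\<close>

definition polys_upto :: "nat \<Rightarrow> ('n::finite) mpoly set"
  where "polys_upto t = {p. total_degree p \<le> t}"

definition eval_poly :: "('n::finite) mpoly \<Rightarrow> real ^ 'n \<Rightarrow> real"
  where "eval_poly p x =
    (\<Sum>\<alpha>\<in>Poly_Mapping.keys p. Poly_Mapping.lookup p \<alpha> *
       (\<Prod>i\<in>UNIV. (x $ i) ^ Poly_Mapping.lookup \<alpha> i))"

text \<open>\<open>translate y p\<close> is the polynomial \<open>p'(u) = p(u + y)\<close>, expanded in \<open>u\<close>.\<close>

definition translate :: "real ^ 'n \<Rightarrow> ('n::finite) mpoly \<Rightarrow> 'n mpoly"
  where "translate y p =
    (\<Sum>\<alpha>\<in>Poly_Mapping.keys p. const_poly (Poly_Mapping.lookup p \<alpha>) *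
       (\<Prod>i\<in>UNIV. (var_poly i + const_poly (y $ i)) ^ Poly_Mapping.lookup \<alpha> i))"

definition poly_l1_norm :: "'n mpoly \<Rightarrow> real"
  where "poly_l1_norm p = (\<Sum>\<alpha>\<in>Poly_Mapping.keys p. \<bar>Poly_Mapping.lookup p \<alpha>\<bar>)"

text \<open>\<open>\<Sigma>[x]\<^sub>d\<close>: the degree bound \<open>2 * d\<close> is on the sum of squares, not on the polynomials
  that are squared.\<close>

definition sos_upto :: "nat \<Rightarrow> ('n::finite) mpoly set"
  where "sos_upto d = {p \<in> polys_upto (2 * d). \<exists>qs. p = (\<Sum>q\<leftarrow>qs. q ^ 2)}"

definition hypercube :: "(real ^ 'n) set"
  where "hypercube = {x. \<forall>i. x $ i \<in> {0, 1}}"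

text \<open>For \<open>d \<ge> 1\<close> (so that \<open>2 * d - 2\<close> is not truncated), \<open>cube_certificate d p \<sigma>\<^sub>0 \<sigma>\<close> says that
  \<open>p = \<sigma>\<^sub>0 + (\<Sum>i. (x\<^sub>i\<^sup>2 - x\<^sub>i) * \<sigma>\<^sub>i)\<close> as polynomials, with the prescribed degrees.\<close>

definition cube_certificate ::
    "nat \<Rightarrow> ('n::finite) mpoly \<Rightarrow> 'n mpoly \<Rightarrow> ('n \<Rightarrow> 'n mpoly) \<Rightarrow> bool"
  where "cube_certificate d p \<sigma>0 \<sigma> \<longleftrightarrow>
    \<sigma>0 \<in> sos_upto d \<and> (\<forall>i. \<sigma> i \<in> polys_upto (2 * d - 2)) \<and>
    p = \<sigma>0 + (\<Sum>i\<in>UNIV. (var_poly i ^ 2 - var_poly i) * \<sigma> i)"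

definition linear_form_at :: "real ^ 'n \<Rightarrow> real ^ 'n \<Rightarrow> ('n::finite) mpoly" \<comment> \<open>\<open>b\<^sup>T (x - y)\<close>\<close>
  where "linear_form_at y b = (\<Sum>i\<in>UNIV. const_poly (b $ i) * (var_poly i - const_poly (y $ i)))"

definition sign_pattern :: "real ^ 'n \<Rightarrow> real ^ 'n \<Rightarrow> bool"
  where "sign_pattern y b \<longleftrightarrow> (\<forall>i. (y $ i = 0 \<longrightarrow> b $ i \<ge> 0) \<and> (y $ i = 1 \<longrightarrow> b $ i \<le> 0))"

text \<open>The inverse problem at \<open>y\<close> for the \<open>\<ell>\<^sub>1\<close>-norm of the coefficients in \<open>u = x - y\<close>.\<close>

definition inverse_feasible ::
    "nat \<Rightarrow> ('n::finite) mpoly \<Rightarrow> real ^ 'n \<Rightarrow> 'n mpoly \<Rightarrow> bool"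
  where "inverse_feasible d f y g \<longleftrightarrow>
    g \<in> polys_upto (total_degree f) \<and>
    (\<exists>\<sigma>0 \<sigma>. cube_certificate d (g - const_poly (eval_poly g y)) \<sigma>0 \<sigma>)"

definition inverse_objective :: "('n::finite) mpoly \<Rightarrow> real ^ 'n \<Rightarrow> 'n mpoly \<Rightarrow> real"
  where "inverse_objective f y g = poly_l1_norm (translate y f - translate y g)"

definition inverse_optimal ::
    "nat \<Rightarrow> ('n::finite) mpoly \<Rightarrow> real ^ 'n \<Rightarrow> 'n mpoly \<Rightarrow> bool"
  where "inverse_optimal d f y = is_arg_min (inverse_objective f y) (inverse_feasible d f y)"

text \<open>The semidefinite program, with decision variables \<open>(b, \<sigma>\<^sub>0, \<sigma>)\<close>.\<close>

definition sdp_feasible ::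
    "nat \<Rightarrow> ('n::finite) mpoly \<Rightarrow> real ^ 'n \<Rightarrow>
      (real ^ 'n) \<times> 'n mpoly \<times> ('n \<Rightarrow> 'n mpoly) \<Rightarrow> bool"
  where "sdp_feasible d f y = (\<lambda>(b, \<sigma>0, \<sigma>). sign_pattern y b \<and>
    cube_certificate d (f - const_poly (eval_poly f y) + linear_form_at y b) \<sigma>0 \<sigma>)"

definition sdp_objective ::
    "real ^ 'n \<Rightarrow> (real ^ 'n) \<times> ('n::finite) mpoly \<times> ('n \<Rightarrow> 'n mpoly) \<Rightarrow> real"
  where "sdp_objective y = (\<lambda>(b, \<sigma>0, \<sigma>). (\<Sum>i | y $ i = 0. b $ i) - (\<Sum>i | y $ i = 1. b $ i))"

definition sdp_optimal ::
    "nat \<Rightarrow> ('n::finite) mpoly \<Rightarrow> real ^ 'n \<Rightarrow>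
      (real ^ 'n) \<times> 'n mpoly \<times> ('n \<Rightarrow> 'n mpoly) \<Rightarrow> bool"
  where "sdp_optimal d f y = is_arg_min (sdp_objective y) (sdp_feasible d f y)"

end

theory Submission
  imports Defs
begin

text \<open>Two facts carry the theorem: a perturbation of \<open>f\<close> can be replaced by a linear one at no extra
  cost, and the cheapest linear one exists.

  Write \<open>v\<^sub>i = \<plusminus>(x\<^sub>i - y\<^sub>i)\<close>, with the sign chosen such that \<open>v\<^sub>i\<close> takes the values 0 and 1 on the cube.
  If \<open>g\<close> is feasible, then \<open>f - f(y)\<close> equals \<open>g - g(y)\<close>, which is certified, plus a combination of
  nonconstant monomials \<open>c\<^sub>\<alpha> v\<^sup>\<alpha>\<close>, where \<open>\<bar>c\<^sub>\<alpha>\<bar>\<close> are the absolute values of the coefficients of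
  \<open>f - g\<close> in \<open>u = x - y\<close>. If \<open>x\<^sub>i\<close> occurs in \<open>x\<^sup>\<alpha>\<close>, then on the cube \<open>v\<^sub>i + v\<^sup>\<alpha>\<close> is \<open>v\<^sub>i\<^sup>2 + (v\<^sup>\<alpha>)\<^sup>2\<close>
  and \<open>v\<^sub>i - v\<^sup>\<alpha>\<close> is \<open>(v\<^sub>i - v\<^sup>\<alpha>)\<^sup>2\<close>, so adding \<open>\<bar>c\<^sub>\<alpha>\<bar> v\<^sub>i\<close> makes up for \<open>c\<^sub>\<alpha> v\<^sup>\<alpha>\<close>. The sum of these
  corrections is a form \<open>b\<^sup>T (x - y)\<close> with the required signs and \<open>\<parallel>b\<parallel>\<^sub>1 \<le> \<parallel>f' - g'\<parallel>\<^sub>1\<close>; this is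
  \<open>linear_dominates_perturbation\<close>.

  All of this happens on the vertices, because a certificate is a condition on values: by
  \<open>cube_certificate_iff\<close>, a polynomial of degree at most \<open>2d\<close> has one iff its vector of values on the
  cube lies in the cone generated by the squares of polynomials of degree at most \<open>d\<close>. One direction
  reduces modulo \<open>x\<^sub>i\<^sup>2 - x\<^sub>i\<close> without raising degrees and uses that a multilinear polynomial vanishing
  on the cube is zero. The other uses that the leading terms of a sum of squares cannot cancel
  (\<open>sum_squares_degree\<close>).

  The cone lives in a finite-dimensional space and is generated by a compact set of squares whose
  convex hull misses 0, so it is closed (\<open>closed_cube_sos\<close>). Hence the admissible \<open>b\<close> form a closed
  set, and one of them has the least \<open>\<ell>\<^sub>1\<close>-norm. By domination it is optimal among all \<open>g\<close>, and the
  optimal value of the inverse problem and that of the semidefinite program agree.\<close>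

section \<open>Substitution homomorphisms\<close>

text \<open>Evaluation, translation and any other substitution are the same sum with different target rings;
  their ring laws are proved once, for \<open>c\<close> a ring homomorphism on the coefficients.\<close>

definition poly_hom :: "(real \<Rightarrow> 'a::comm_ring_1) \<Rightarrow> ('n \<Rightarrow> 'a) \<Rightarrow> ('n::finite) mpoly \<Rightarrow> 'a"
  where "poly_hom c \<phi> p =
    (\<Sum>\<alpha>\<in>Poly_Mapping.keys p. c (Poly_Mapping.lookup p \<alpha>) * (\<Prod>i\<in>UNIV. \<phi> i ^ Poly_Mapping.lookup \<alpha> i))"

lemma poly_mapping_sum_monomials:
  fixes p :: "'a \<Rightarrow>\<^sub>0 'b::comm_monoid_add"
  shows "p = (\<Sum>\<alpha>\<in>Poly_Mapping.keys p. Poly_Mapping.single \<alpha> (Poly_Mapping.lookup p \<alpha>))"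
proof (rule poly_mapping_eqI)
  fix k
  have "Poly_Mapping.lookup (\<Sum>\<alpha>\<in>Poly_Mapping.keys p. Poly_Mapping.single \<alpha> (Poly_Mapping.lookup p \<alpha>)) k
      = (\<Sum>\<alpha>\<in>Poly_Mapping.keys p. if k = \<alpha> then Poly_Mapping.lookup p \<alpha> else 0)"
    unfolding lookup_sum by (rule sum.cong) (auto simp: lookup_single when_def)
  also have "\<dots> = Poly_Mapping.lookup p k"
    by (simp add: in_keys_iff)
  finally show "Poly_Mapping.lookup p k =
      Poly_Mapping.lookup (\<Sum>\<alpha>\<in>Poly_Mapping.keys p. Poly_Mapping.single \<alpha> (Poly_Mapping.lookup p \<alpha>)) k"
    by simp
qed

lemma mult_sum_monomials:
  fixes p q :: "'a::monoid_add \<Rightarrow>\<^sub>0 'b::semiring_0"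
  shows "p * q = (\<Sum>l\<in>Poly_Mapping.keys p. \<Sum>r\<in>Poly_Mapping.keys q.
    Poly_Mapping.single (l + r) (Poly_Mapping.lookup p l * Poly_Mapping.lookup q r))"
  by (subst poly_mapping_sum_monomials[of p], subst poly_mapping_sum_monomials[of q])
     (simp add: sum_product mult_single)

lemma lookup_mult_keys:
  fixes p q :: "'a::monoid_add \<Rightarrow>\<^sub>0 'b::semiring_0"
  shows "Poly_Mapping.lookup (p * q) k =
    (\<Sum>l\<in>Poly_Mapping.keys p. \<Sum>r\<in>Poly_Mapping.keys q.
      if l + r = k then Poly_Mapping.lookup p l * Poly_Mapping.lookup q r else 0)"
  by (subst mult_sum_monomials) (simp add: lookup_sum lookup_single when_def)

locale real_coeff_hom =
  fixes c :: "real \<Rightarrow> 'a::comm_ring_1"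
  assumes c_add: "c (a + b) = c a + c b" and c_mult: "c (a * b) = c a * c b" and c_one: "c 1 = 1"
begin

lemma c_zero: "c 0 = 0"
  using c_add[of 0 0] by simp

lemma poly_hom_add: "poly_hom c \<phi> (p + q) = poly_hom c \<phi> p + poly_hom c \<phi> q"
  unfolding poly_hom_def
  by (rule setsum_keys_plus_distrib) (auto simp: c_zero c_add algebra_simps)

lemma poly_hom_zero: "poly_hom c \<phi> 0 = 0"
  by (simp add: poly_hom_def)

lemma poly_hom_uminus: "poly_hom c \<phi> (- p) = - poly_hom c \<phi> p"
  using poly_hom_add[of \<phi> p "- p"] by (simp add: poly_hom_zero minus_unique)

lemma poly_hom_diff: "poly_hom c \<phi> (p - q) = poly_hom c \<phi> p - poly_hom c \<phi> q"
  using poly_hom_add[of \<phi> p "- q"] by (simp add: poly_hom_uminus)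

lemma poly_hom_sum: "poly_hom c \<phi> (\<Sum>x\<in>A. g x) = (\<Sum>x\<in>A. poly_hom c \<phi> (g x))"
  by (induction A rule: infinite_finite_induct) (auto simp: poly_hom_zero poly_hom_add)

lemma poly_hom_single:
  "poly_hom c \<phi> (Poly_Mapping.single \<alpha> a) = c a * (\<Prod>i\<in>UNIV. \<phi> i ^ Poly_Mapping.lookup \<alpha> i)"
  by (cases "a = 0") (auto simp: poly_hom_def c_zero)

lemma poly_hom_const: "poly_hom c \<phi> (const_poly a) = c a"
  by (simp add: const_poly_def poly_hom_single)

lemma poly_hom_var: "poly_hom c \<phi> (var_poly i) = \<phi> i"
proof -
  have "(\<Prod>j\<in>UNIV. \<phi> j ^ Poly_Mapping.lookup (Poly_Mapping.single i (1::nat)) j) =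
      (\<Prod>j\<in>UNIV. if j = i then \<phi> i else 1)"
    by (rule prod.cong) (auto simp: lookup_single when_def)
  then show ?thesis
    by (simp add: var_poly_def poly_hom_single c_one)
qed

lemma poly_hom_mult: "poly_hom c \<phi> (p * q) = poly_hom c \<phi> p * poly_hom c \<phi> q"
proof -
  have "poly_hom c \<phi> (p * q) = (\<Sum>l\<in>Poly_Mapping.keys p. \<Sum>r\<in>Poly_Mapping.keys q.
      (c (Poly_Mapping.lookup p l) * (\<Prod>i\<in>UNIV. \<phi> i ^ Poly_Mapping.lookup l i)) *
      (c (Poly_Mapping.lookup q r) * (\<Prod>i\<in>UNIV. \<phi> i ^ Poly_Mapping.lookup r i)))"
    by (subst mult_sum_monomials) (simp add: poly_hom_sum poly_hom_single c_mult lookup_add power_add prod.distrib mult_ac)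
  then show ?thesis
    by (simp add: poly_hom_def sum_product)
qed

lemma poly_hom_one: "poly_hom c \<phi> 1 = 1"
  using poly_hom_const[of \<phi> 1] by (simp add: const_poly_def c_one)

lemma poly_hom_power: "poly_hom c \<phi> (p ^ k) = poly_hom c \<phi> p ^ k"
  by (induction k) (auto simp: poly_hom_one poly_hom_mult)

lemma poly_hom_prod: "poly_hom c \<phi> (\<Prod>x\<in>A. g x) = (\<Prod>x\<in>A. poly_hom c \<phi> (g x))"
  by (induction A rule: infinite_finite_induct) (auto simp: poly_hom_one poly_hom_mult)

lemma poly_hom_comp:
  "poly_hom c \<phi> (poly_hom const_poly \<psi> p) = poly_hom c (\<lambda>i. poly_hom c \<phi> (\<psi> i)) p"
  unfolding poly_hom_def[of const_poly]
  by (simp add: poly_hom_sum poly_hom_mult poly_hom_const poly_hom_prod poly_hom_power)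
     (simp add: poly_hom_def)

lemmas poly_hom_simps = poly_hom_add poly_hom_zero poly_hom_uminus poly_hom_diff poly_hom_sum
  poly_hom_const poly_hom_var poly_hom_mult poly_hom_one poly_hom_power poly_hom_prod

end

lemma eval_poly_hom: "eval_poly p x = poly_hom (\<lambda>a. a) (($) x) p"
  by (simp add: eval_poly_def poly_hom_def)

lemma translate_hom: "translate y p = poly_hom const_poly (\<lambda>i. var_poly i + const_poly (y $ i)) p"
  by (simp add: translate_def poly_hom_def)

interpretation real_hom: real_coeff_hom "\<lambda>a::real. a"
  by standard auto

interpretation const_hom: real_coeff_hom "const_poly :: real \<Rightarrow> ('n::finite) mpoly"
  by standard (auto simp: const_poly_def single_add mult_single)

lemmas eval_poly_simps = real_hom.poly_hom_simps[where \<phi> = "($) (x :: real ^ 'n)" for x, folded eval_poly_hom]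
lemmas translate_simps = const_hom.poly_hom_simps[where \<phi> = "\<lambda>i. var_poly i + const_poly ((y :: real ^ 'n) $ i)" for y,
  folded translate_hom]

lemma eval_translate: "eval_poly (translate y p) u = eval_poly p (u + y)"
proof -
  have "($) (u + y) = (\<lambda>i. u $ i + y $ i)" by auto
  then show ?thesis
    by (simp add: translate_hom eval_poly_hom real_hom.poly_hom_comp real_hom.poly_hom_simps)
qed

lemma eval_linear_form: "eval_poly (linear_form_at y b) x = (\<Sum>i\<in>UNIV. b $ i * (x $ i - y $ i))"
  by (simp add: linear_form_at_def eval_poly_simps)

section \<open>Degrees\<close>

definition mdeg :: "('n::finite \<Rightarrow>\<^sub>0 nat) \<Rightarrow> nat"
  where "mdeg \<alpha> = (\<Sum>i\<in>UNIV. Poly_Mapping.lookup \<alpha> i)"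

lemma mdeg_add: "mdeg (\<alpha> + \<beta>) = mdeg \<alpha> + mdeg \<beta>"
  by (simp add: mdeg_def lookup_add sum.distrib)

lemma mdeg_single: "mdeg (Poly_Mapping.single i k) = k"
  by (simp add: mdeg_def lookup_single when_def)

lemma polys_upto_iff: "p \<in> polys_upto t \<longleftrightarrow> (\<forall>\<alpha>\<in>Poly_Mapping.keys p. mdeg \<alpha> \<le> t)"
  by (auto simp: polys_upto_def total_degree_def mdeg_def)

lemma polys_upto_mono: "p \<in> polys_upto s \<Longrightarrow> s \<le> t \<Longrightarrow> p \<in> polys_upto t"
  by (auto simp: polys_upto_def)

lemma polys_upto_total_degree: "p \<in> polys_upto (total_degree p)"
  by (simp add: polys_upto_def)

lemma polys_upto_zero: "0 \<in> polys_upto t"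
  by (simp add: polys_upto_iff)

lemma polys_upto_add: "p \<in> polys_upto t \<Longrightarrow> q \<in> polys_upto t \<Longrightarrow> p + q \<in> polys_upto t"
  using keys_add[of p q] by (auto simp: polys_upto_iff)

lemma polys_upto_uminus: "p \<in> polys_upto t \<Longrightarrow> - p \<in> polys_upto t"
  by (auto simp: polys_upto_iff in_keys_iff)

lemma polys_upto_diff: "p \<in> polys_upto t \<Longrightarrow> q \<in> polys_upto t \<Longrightarrow> p - q \<in> polys_upto t"
  using polys_upto_add[of p t "- q"] polys_upto_uminus[of q t] by simp

lemma polys_upto_sum: "(\<And>x. x \<in> A \<Longrightarrow> g x \<in> polys_upto t) \<Longrightarrow> (\<Sum>x\<in>A. g x) \<in> polys_upto t"
  by (induction A rule: infinite_finite_induct) (auto simp: polys_upto_zero polys_upto_add)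

lemma polys_upto_sum_list: "(\<And>x. x \<in> set xs \<Longrightarrow> g x \<in> polys_upto t) \<Longrightarrow> (\<Sum>x\<leftarrow>xs. g x) \<in> polys_upto t"
  by (induction xs) (auto simp: polys_upto_zero polys_upto_add)

lemma polys_upto_mult: "p \<in> polys_upto s \<Longrightarrow> q \<in> polys_upto t \<Longrightarrow> p * q \<in> polys_upto (s + t)"
  using keys_mult[of p q] by (fastforce simp: polys_upto_iff mdeg_add intro: add_mono)

lemma polys_upto_single: "mdeg \<alpha> \<le> t \<Longrightarrow> Poly_Mapping.single \<alpha> a \<in> polys_upto t"
  by (simp add: polys_upto_iff)

lemma polys_upto_const: "const_poly a \<in> polys_upto t"
  unfolding const_poly_def by (rule polys_upto_single) (simp add: mdeg_def)

lemma polys_upto_var: "1 \<le> t \<Longrightarrow> var_poly i \<in> polys_upto t"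
  unfolding var_poly_def by (rule polys_upto_single) (simp add: mdeg_single)

lemma polys_upto_one: "1 \<in> polys_upto t"
  by (simp add: polys_upto_iff mdeg_def)

lemma polys_upto_power: "p \<in> polys_upto t \<Longrightarrow> p ^ k \<in> polys_upto (k * t)"
  by (induction k) (auto simp: polys_upto_one intro: polys_upto_mult)

lemma polys_upto_prod:
  "(\<And>x. x \<in> A \<Longrightarrow> g x \<in> polys_upto (t x)) \<Longrightarrow> (\<Prod>x\<in>A. g x) \<in> polys_upto (\<Sum>x\<in>A. t x)"
  by (induction A rule: infinite_finite_induct) (auto simp: polys_upto_one intro: polys_upto_mult)

lemma polys_upto_monomial_subst:
  assumes "\<And>i. \<phi> i \<in> polys_upto 1"
  shows "(\<Prod>i\<in>UNIV. \<phi> i ^ Poly_Mapping.lookup \<alpha> i) \<in> polys_upto (mdeg \<alpha>)"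
  unfolding mdeg_def using polys_upto_power[OF assms]
  by (intro polys_upto_prod) simp

lemma polys_upto_translate:
  assumes "p \<in> polys_upto t"
  shows "translate y p \<in> polys_upto t"
  unfolding translate_def
proof (rule polys_upto_sum)
  fix \<alpha> assume "\<alpha> \<in> Poly_Mapping.keys p"
  then have "mdeg \<alpha> \<le> t" using assms by (simp add: polys_upto_iff)
  moreover have "(\<Prod>i\<in>UNIV. (var_poly i + const_poly (y $ i)) ^ Poly_Mapping.lookup \<alpha> i) \<in> polys_upto (mdeg \<alpha>)"
    by (intro polys_upto_monomial_subst polys_upto_add polys_upto_var polys_upto_const) simp
  ultimately show "const_poly (Poly_Mapping.lookup p \<alpha>) *
      (\<Prod>i\<in>UNIV. (var_poly i + const_poly (y $ i)) ^ Poly_Mapping.lookup \<alpha> i) \<in> polys_upto t"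
    using polys_upto_mult[OF polys_upto_const[of _ 0]] polys_upto_mono by fastforce
qed

lemma polys_upto_linear_form: "1 \<le> t \<Longrightarrow> linear_form_at y b \<in> polys_upto t"
  unfolding linear_form_at_def
  using polys_upto_mult[OF polys_upto_const[of _ 0] polys_upto_diff[OF polys_upto_var polys_upto_const], of t]
  by (intro polys_upto_sum) simp

text \<open>Leading terms of squares of real polynomials do not cancel. Among the exponents of maximal total
  degree occurring in any \<open>q\<close>, let \<open>\<alpha>\<close> have the largest Euclidean norm. By strict convexity of the norm,
  \<open>\<alpha> + \<alpha>\<close> is a sum of two occurring exponents in only one way, so its coefficient in the sum of squares
  is \<open>\<Sum> (q\<^sub>\<alpha>)\<^sup>2 > 0\<close>. This extremal choice stands in for a monomial order, which would require an order
  on the variables.\<close>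

lemma sum_squares_degree:
  fixes qs :: "('n::finite) mpoly list"
  assumes sq: "(\<Sum>q\<leftarrow>qs. q ^ 2) \<in> polys_upto (2 * d)" and "q \<in> set qs"
  shows "q \<in> polys_upto d"
proof (rule ccontr)
  assume "q \<notin> polys_upto d"
  define K where "K = (\<Union>q\<in>set qs. Poly_Mapping.keys q)"
  define m where "m = Max (mdeg ` K)"
  define N where "N \<alpha> = (\<Sum>i\<in>UNIV. (real (Poly_Mapping.lookup \<alpha> i))\<^sup>2)" for \<alpha> :: "'n \<Rightarrow>\<^sub>0 nat"
  have finK: "finite K" by (simp add: K_def)
  obtain \<gamma> where \<gamma>: "\<gamma> \<in> K" "mdeg \<gamma> > d"
    using \<open>q \<notin> polys_upto d\<close> \<open>q \<in> set qs\<close> by (force simp: polys_upto_iff K_def)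
  have le_m: "mdeg \<beta> \<le> m" if "\<beta> \<in> K" for \<beta>
    using that finK by (simp add: m_def)
  have "m \<in> mdeg ` K" unfolding m_def using finK \<gamma> by (intro Max_in) auto
  then have "{\<beta>\<in>K. mdeg \<beta> = m} \<noteq> {}" by auto
  then obtain \<alpha> where \<alpha>_top: "\<alpha> \<in> {\<beta>\<in>K. mdeg \<beta> = m}" and N_max: "Max (N ` {\<beta>\<in>K. mdeg \<beta> = m}) = N \<alpha>"
    using finK by (rule_tac obtains_MAX[of "{\<beta>\<in>K. mdeg \<beta> = m}" N]) auto
  then have \<alpha>: "\<alpha> \<in> K" "mdeg \<alpha> = m" by auto
  have max: "N \<beta> \<le> N \<alpha>" if "\<beta> \<in> K" "mdeg \<beta> = m" for \<beta>
    unfolding N_max[symmetric] using that finK by (intro Max_ge) auto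
  \<comment> \<open>equality in \<open>N l + N r \<ge> 2 N \<alpha>\<close>, valid whenever \<open>\<alpha>\<close> is the midpoint, forces \<open>l = r = \<alpha>\<close>\<close>
  have extremal: "l = \<alpha> \<and> r = \<alpha>" if "l \<in> K" "r \<in> K" and eq: "l + r = \<alpha> + \<alpha>" for l r
  proof -
    have "mdeg l + mdeg r = m + m"
      using arg_cong[OF eq, of mdeg] by (simp add: mdeg_add \<alpha>)
    with le_m[OF that(1)] le_m[OF that(2)] have "mdeg l = m" "mdeg r = m" by auto
    with max that have N: "N l \<le> N \<alpha>" "N r \<le> N \<alpha>" by auto
    let ?L = "\<lambda>\<beta> i. real (Poly_Mapping.lookup \<beta> i)"
    have lr: "?L l i + ?L r i = 2 * ?L \<alpha> i" for i
      using arg_cong[OF eq, of "\<lambda>\<beta>. ?L \<beta> i"] by (simp add: lookup_add)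
    have "(?L l i - ?L \<alpha> i)\<^sup>2 + (?L r i - ?L \<alpha> i)\<^sup>2 = (?L l i)\<^sup>2 + (?L r i)\<^sup>2 - 2 * (?L \<alpha> i)\<^sup>2" for i
    proof -
      have "?L r i = 2 * ?L \<alpha> i - ?L l i" using lr[of i] by simp
      then show ?thesis by (simp only:) (simp add: power2_eq_square algebra_simps)
    qed
    then have "(\<Sum>i\<in>UNIV. (?L l i - ?L \<alpha> i)\<^sup>2 + (?L r i - ?L \<alpha> i)\<^sup>2) = N l + N r - 2 * N \<alpha>"
      by (simp add: N_def sum.distrib sum_subtractf sum_distrib_left)
    then have "(\<Sum>i\<in>UNIV. (?L l i - ?L \<alpha> i)\<^sup>2 + (?L r i - ?L \<alpha> i)\<^sup>2) = 0"
      using N by (intro antisym sum_nonneg) auto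
    then have "\<forall>i. (?L l i - ?L \<alpha> i)\<^sup>2 + (?L r i - ?L \<alpha> i)\<^sup>2 = 0"
      by (subst (asm) sum_nonneg_eq_0_iff) auto
    then show ?thesis
      by (auto intro!: poly_mapping_eqI simp: add_nonneg_eq_0_iff)
  qed
  have coeff: "Poly_Mapping.lookup (q ^ 2) (\<alpha> + \<alpha>) = (Poly_Mapping.lookup q \<alpha>)\<^sup>2" if "q \<in> set qs" for q
  proof -
    have K: "Poly_Mapping.keys q \<subseteq> K" using that by (auto simp: K_def)
    have "Poly_Mapping.lookup (q ^ 2) (\<alpha> + \<alpha>) = (\<Sum>l\<in>Poly_Mapping.keys q. \<Sum>r\<in>Poly_Mapping.keys q.
        if r = \<alpha> then (if l = \<alpha> then (Poly_Mapping.lookup q \<alpha>)\<^sup>2 else 0) else 0)"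
      unfolding power2_eq_square lookup_mult_keys
      using K extremal by (intro sum.cong refl) (auto simp: subset_iff)
    also have "\<dots> = (Poly_Mapping.lookup q \<alpha>)\<^sup>2"
      by (cases "\<alpha> \<in> Poly_Mapping.keys q") (auto simp: in_keys_iff)
    finally show ?thesis .
  qed
  have lookup_list: "Poly_Mapping.lookup (\<Sum>q\<leftarrow>xs. q ^ 2) k = (\<Sum>q\<leftarrow>xs. Poly_Mapping.lookup (q ^ 2) k)"
    for xs :: "'n mpoly list" and k
    by (induction xs) (auto simp: lookup_add)
  obtain q0 where q0: "q0 \<in> set qs" "\<alpha> \<in> Poly_Mapping.keys q0"
    using \<alpha> by (auto simp: K_def)
  have "0 < (Poly_Mapping.lookup q0 \<alpha>)\<^sup>2" using q0 by (simp add: in_keys_iff)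
  also have "\<dots> \<le> (\<Sum>q\<leftarrow>qs. (Poly_Mapping.lookup q \<alpha>)\<^sup>2)"
    using q0 by (intro member_le_sum_list) auto
  also have "\<dots> = Poly_Mapping.lookup (\<Sum>q\<leftarrow>qs. q ^ 2) (\<alpha> + \<alpha>)"
    unfolding lookup_list by (intro arg_cong[of _ _ sum_list] map_cong refl) (simp add: coeff)
  finally have "\<alpha> + \<alpha> \<in> Poly_Mapping.keys (\<Sum>q\<leftarrow>qs. q ^ 2)"
    by (simp add: in_keys_iff)
  with sq have "mdeg (\<alpha> + \<alpha>) \<le> 2 * d" by (simp only: polys_upto_iff)
  with \<alpha> le_m[OF \<gamma>(1)] \<gamma>(2) show False by (simp add: mdeg_add)
qed

section \<open>Reduction modulo the cube\<close>

definition multilinear :: "('n::finite) mpoly \<Rightarrow> bool"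
  where "multilinear r \<longleftrightarrow> (\<forall>\<alpha>\<in>Poly_Mapping.keys r. \<forall>i. Poly_Mapping.lookup \<alpha> i \<le> 1)"

text \<open>Division of \<open>p\<close> by the polynomials \<open>x\<^sub>i\<^sup>2 - x\<^sub>i\<close>, with a multilinear remainder and quotients within
  the degree bound that certificates impose.\<close>

definition cube_reducible :: "nat \<Rightarrow> ('n::finite) mpoly \<Rightarrow> bool"
  where "cube_reducible t p \<longleftrightarrow> (\<exists>r \<sigma>. multilinear r \<and> (\<forall>i. \<sigma> i \<in> polys_upto (t - 2)) \<and>
    p = r + (\<Sum>i\<in>UNIV. (var_poly i ^ 2 - var_poly i) * \<sigma> i))"

lemma cube_reducible_add:
  assumes "cube_reducible t p" "cube_reducible t q"
  shows "cube_reducible t (p + q)"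
proof -
  obtain r \<sigma> r' \<sigma>' where *: "multilinear r" "\<forall>i. \<sigma> i \<in> polys_upto (t - 2)"
      "p = r + (\<Sum>i\<in>UNIV. (var_poly i ^ 2 - var_poly i) * \<sigma> i)"
      "multilinear r'" "\<forall>i. \<sigma>' i \<in> polys_upto (t - 2)"
      "q = r' + (\<Sum>i\<in>UNIV. (var_poly i ^ 2 - var_poly i) * \<sigma>' i)"
    using assms by (auto simp: cube_reducible_def)
  have "multilinear (r + r')"
    using * keys_add[of r r'] by (auto simp: multilinear_def)
  moreover have "\<forall>i. \<sigma> i + \<sigma>' i \<in> polys_upto (t - 2)"
    using * by (auto intro: polys_upto_add)
  moreover have "p + q = (r + r') + (\<Sum>i\<in>UNIV. (var_poly i ^ 2 - var_poly i) * (\<sigma> i + \<sigma>' i))"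
    using * by (simp add: distrib_left sum.distrib)
  ultimately show ?thesis
    unfolding cube_reducible_def by (intro exI[of _ "r + r'"] exI[of _ "\<lambda>i. \<sigma> i + \<sigma>' i"]) simp
qed

lemma cube_reducible_zero: "cube_reducible t 0"
  unfolding cube_reducible_def
  by (intro exI[of _ 0] exI[of _ "\<lambda>_. 0"]) (simp add: multilinear_def polys_upto_zero)

text \<open>One step replaces a factor \<open>x\<^sub>i\<^sup>2\<close> by \<open>x\<^sub>i\<close>; it lowers the degree by one, and its quotient
  \<open>x\<^sup>\<alpha> / x\<^sub>i\<^sup>2\<close> has degree \<open>\<bar>\<alpha>\<bar> - 2\<close>.\<close>

lemma cube_reducible_monomial: "mdeg \<alpha> \<le> t \<Longrightarrow> cube_reducible t (Poly_Mapping.single \<alpha> a)"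
proof (induction "mdeg \<alpha>" arbitrary: \<alpha> rule: less_induct)
  case less
  show ?case
  proof (cases "\<forall>i. Poly_Mapping.lookup \<alpha> i \<le> 1")
    case True
    then have "multilinear (Poly_Mapping.single \<alpha> a)" by (simp add: multilinear_def)
    then show ?thesis
      unfolding cube_reducible_def
      by (intro exI[of _ "Poly_Mapping.single \<alpha> a"] exI[of _ "\<lambda>_. 0"]) (simp add: polys_upto_zero)
  next
    case False
    then obtain i where "\<not> Poly_Mapping.lookup \<alpha> i \<le> 1" by blast
    then have i: "Poly_Mapping.lookup \<alpha> i \<ge> 2" by simp
    define \<beta> where "\<beta> = \<alpha> - Poly_Mapping.single i 2"
    have \<alpha>: "\<alpha> = \<beta> + Poly_Mapping.single i 2"
      unfolding \<beta>_def using i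
      by (intro poly_mapping_eqI) (auto simp: lookup_add lookup_minus lookup_single when_def)
    have deg: "mdeg \<alpha> = mdeg \<beta> + 2" by (simp add: \<alpha> mdeg_add mdeg_single)
    have red: "cube_reducible t (Poly_Mapping.single (\<beta> + Poly_Mapping.single i 1) a)"
      using less deg by (intro less.hyps) (auto simp: mdeg_add mdeg_single)
    have "cube_reducible t ((var_poly i ^ 2 - var_poly i) * Poly_Mapping.single \<beta> a)"
      unfolding cube_reducible_def
    proof (intro exI conjI)
      show "multilinear (0 :: 'a mpoly)" by (simp add: multilinear_def)
      show "\<forall>j. (if j = i then Poly_Mapping.single \<beta> a else 0) \<in> polys_upto (t - 2)"
        using less.prems deg by (auto intro: polys_upto_single polys_upto_zero)
      show "(var_poly i ^ 2 - var_poly i) * Poly_Mapping.single \<beta> a =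
          0 + (\<Sum>j\<in>UNIV. (var_poly j ^ 2 - var_poly j) * (if j = i then Poly_Mapping.single \<beta> a else 0))"
        by (simp add: if_distrib[of "\<lambda>x. _ * x"] cong: if_cong)
    qed
    moreover have "Poly_Mapping.single \<alpha> a = Poly_Mapping.single (\<beta> + Poly_Mapping.single i 1) a
        + (var_poly i ^ 2 - var_poly i) * Poly_Mapping.single \<beta> a"
    proof -
      have "Poly_Mapping.single i (2::nat) = Poly_Mapping.single i 1 + Poly_Mapping.single i 1"
        by (simp flip: single_add add: numeral_2_eq_2)
      then show ?thesis
        by (simp add: \<alpha> var_poly_def power2_eq_square mult_single left_diff_distrib add.commute)
    qed
    ultimately show ?thesis
      using cube_reducible_add[OF red] by simp
  qed
qed

lemma cube_reducible:
  assumes "p \<in> polys_upto t"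
  shows "cube_reducible t p"
proof -
  have "cube_reducible t (\<Sum>\<alpha>\<in>A. Poly_Mapping.single \<alpha> (Poly_Mapping.lookup p \<alpha>))"
    if "A \<subseteq> Poly_Mapping.keys p" for A
    using finite_subset[OF that finite_keys] that
  proof (induction A rule: finite_induct)
    case empty
    show ?case by (simp add: cube_reducible_zero)
  next
    case (insert \<alpha> A)
    then show ?case
      using assms by (auto simp: polys_upto_iff intro!: cube_reducible_add cube_reducible_monomial)
  qed
  from this[OF order_refl] show ?thesis
    by (simp flip: poly_mapping_sum_monomials)
qed

text \<open>The vertices of the cube, indexed by their supports: with the finite type \<open>'n set\<close> as index, the
  functions on the cube form the Euclidean space \<open>real ^ 'n set\<close>, in which closedness and compactness
  are available and whose product is the pointwise one.\<close>

definition vertex :: "'n::finite set \<Rightarrow> real ^ 'n"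
  where "vertex S = (\<chi> i. if i \<in> S then 1 else 0)"

text \<open>At the vertex that indicates the support of an exponent \<open>\<alpha>\<close> of \<open>r\<close>, only the monomials supported
  inside that of \<open>\<alpha>\<close> survive. If \<open>\<alpha>\<close> has minimal degree, then \<open>\<alpha>\<close> is the only one of them, and the value
  is its coefficient.\<close>

lemma multilinear_vanishing:
  assumes r: "multilinear r" and van: "\<And>S. eval_poly r (vertex S) = 0"
  shows "r = 0"
proof (rule ccontr)
  assume "r \<noteq> 0"
  then have "Poly_Mapping.keys r \<noteq> {}" by simp
  then obtain \<alpha> where \<alpha>: "\<alpha> \<in> Poly_Mapping.keys r" and min: "\<And>\<beta>. \<beta> \<in> Poly_Mapping.keys r \<Longrightarrow> mdeg \<alpha> \<le> mdeg \<beta>"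
    using ex_has_least_nat[of "\<lambda>\<alpha>. \<alpha> \<in> Poly_Mapping.keys r" _ mdeg] by blast
  let ?S = "Poly_Mapping.keys \<alpha>"
  have prod: "(\<Prod>i\<in>UNIV. (vertex ?S $ i) ^ Poly_Mapping.lookup \<beta> i) = (if \<beta> = \<alpha> then 1 else 0)"
    if \<beta>: "\<beta> \<in> Poly_Mapping.keys r" for \<beta>
  proof (cases "\<beta> = \<alpha>")
    case True
    then show ?thesis by (auto simp: vertex_def in_keys_iff intro!: prod.neutral)
  next
    case False
    have "\<exists>i. i \<notin> ?S \<and> Poly_Mapping.lookup \<beta> i \<noteq> 0"
    proof (rule ccontr)
      assume no: "\<not> ?thesis"
      have zero: "Poly_Mapping.lookup \<beta> i = 0" if "Poly_Mapping.lookup \<alpha> i = 0" for i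
        using no that by (metis in_keys_iff)
      have le: "Poly_Mapping.lookup \<beta> i \<le> Poly_Mapping.lookup \<alpha> i" for i
      proof (cases "Poly_Mapping.lookup \<alpha> i = 0")
        case False
        moreover have "Poly_Mapping.lookup \<beta> i \<le> 1" using r \<beta> by (simp add: multilinear_def)
        ultimately show ?thesis by linarith
      qed (simp add: zero)
      have "mdeg \<beta> = mdeg \<alpha>"
        using min[OF \<beta>] le by (intro antisym) (auto simp: mdeg_def intro: sum_mono)
      then have "Poly_Mapping.lookup \<beta> i = Poly_Mapping.lookup \<alpha> i" for i
        using le by (intro sum_mono_inv[of "Poly_Mapping.lookup \<beta>" UNIV]) (auto simp: mdeg_def)
      with False show False by (auto intro: poly_mapping_eqI)
    qed
    then show ?thesis
      using False by (auto simp: vertex_def prod_zero_iff)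
  qed
  have "eval_poly r (vertex ?S) = (\<Sum>\<beta>\<in>Poly_Mapping.keys r. if \<beta> = \<alpha> then Poly_Mapping.lookup r \<alpha> else 0)"
    unfolding eval_poly_def by (intro sum.cong refl) (simp add: prod)
  also have "\<dots> = Poly_Mapping.lookup r \<alpha>" using \<alpha> by simp
  finally show False using van \<alpha> by (simp add: in_keys_iff)
qed

section \<open>The cone of sums of squares on the cube\<close>

definition cube_vals :: "('n::finite) mpoly \<Rightarrow> real ^ ('n set)"
  where "cube_vals p = (\<chi> S. eval_poly p (vertex S))"

definition cube_sos :: "nat \<Rightarrow> (real ^ ('n::finite set)) set"
  where "cube_sos d = convex_cone hull ((\<lambda>q. cube_vals q * cube_vals q) ` polys_upto d)"

lemma cube_vals_nth: "cube_vals p $ S = eval_poly p (vertex S)"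
  by (simp add: cube_vals_def)

lemma cube_vals_add: "cube_vals (p + q) = cube_vals p + cube_vals q"
  by (simp add: vec_eq_iff cube_vals_nth eval_poly_simps)

lemma cube_vals_diff: "cube_vals (p - q) = cube_vals p - cube_vals q"
  by (simp add: vec_eq_iff cube_vals_nth eval_poly_simps)

lemma cube_vals_mult: "cube_vals (p * q) = cube_vals p * cube_vals q"
  by (simp add: vec_eq_iff cube_vals_nth eval_poly_simps)

lemma cube_vals_zero: "cube_vals 0 = 0"
  by (simp add: vec_eq_iff cube_vals_nth eval_poly_simps)

lemma cube_vals_one: "cube_vals 1 = 1"
  by (simp add: vec_eq_iff cube_vals_nth eval_poly_simps)

lemma cube_vals_scale: "cube_vals (const_poly a * p) = a *\<^sub>R cube_vals p"
  by (simp add: vec_eq_iff cube_vals_nth eval_poly_simps)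

lemma cube_vals_sum_list: "cube_vals (\<Sum>q\<leftarrow>qs. g q) = (\<Sum>q\<leftarrow>qs. cube_vals (g q))"
  by (induction qs) (auto simp: cube_vals_zero cube_vals_add)

lemma square_in_cube_sos: "q \<in> polys_upto d \<Longrightarrow> cube_vals q * cube_vals q \<in> cube_sos d"
  unfolding cube_sos_def by (intro hull_inc imageI)

lemma cube_sos_add: "a \<in> cube_sos d \<Longrightarrow> b \<in> cube_sos d \<Longrightarrow> a + b \<in> cube_sos d"
  unfolding cube_sos_def by (rule convex_cone_hull_add)

lemma cube_sos_zero: "0 \<in> cube_sos d"
  unfolding cube_sos_def by (rule convex_cone_hull_contains_0)

lemma cube_sos_scale: "a \<in> cube_sos d \<Longrightarrow> 0 \<le> c \<Longrightarrow> c *\<^sub>R a \<in> cube_sos d"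
  unfolding cube_sos_def by (rule convex_cone_hull_mul)

lemma cube_sos_sum: "(\<And>x. x \<in> A \<Longrightarrow> g x \<in> cube_sos d) \<Longrightarrow> (\<Sum>x\<in>A. g x) \<in> cube_sos d"
  by (induction A rule: infinite_finite_induct) (auto simp: cube_sos_zero intro: cube_sos_add)

lemma cube_sos_sum_list: "(\<And>x. x \<in> set xs \<Longrightarrow> g x \<in> cube_sos d) \<Longrightarrow> (\<Sum>x\<leftarrow>xs. g x) \<in> cube_sos d"
  by (induction xs) (auto simp: cube_sos_zero intro: cube_sos_add)

text \<open>A nonnegative factor can be absorbed into the squares through its square root, so the generated
  cone consists of plain sums of squares.\<close>

lemma cube_sos_explicit:
  assumes "z \<in> cube_sos d"
  obtains qs where "set qs \<subseteq> polys_upto d" "z = cube_vals (\<Sum>q\<leftarrow>qs. q ^ 2)"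
proof -
  let ?C = "{cube_vals (\<Sum>q\<leftarrow>qs. q ^ 2) | qs :: 'a mpoly list. set qs \<subseteq> polys_upto d}"
  have "cube_sos d \<subseteq> ?C"
    unfolding cube_sos_def
  proof (rule hull_minimal)
    show "(\<lambda>q. cube_vals q * cube_vals q) ` polys_upto d \<subseteq> ?C"
    proof clarify
      fix q :: "'a mpoly" assume "q \<in> polys_upto d"
      then show "\<exists>qs. cube_vals q * cube_vals q = cube_vals (\<Sum>q\<leftarrow>qs. q ^ 2) \<and> set qs \<subseteq> polys_upto d"
        by (intro exI[of _ "[q]"]) (simp add: power2_eq_square cube_vals_mult)
    qed
    show "convex_cone ?C"
      unfolding convex_cone_iff
    proof (intro conjI ballI allI impI)
      show "0 \<in> ?C"
        by (auto simp: cube_vals_zero intro!: exI[of _ "[]"])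
    next
      fix x y assume "x \<in> ?C" "y \<in> ?C"
      then obtain ps qs where "x = cube_vals (\<Sum>q\<leftarrow>ps. q ^ 2)" "set ps \<subseteq> polys_upto d"
          "y = cube_vals (\<Sum>q\<leftarrow>qs. q ^ 2)" "set qs \<subseteq> polys_upto d"
        by blast
      then show "x + y \<in> ?C"
        by (auto simp: cube_vals_add intro!: exI[of _ "ps @ qs"])
    next
      fix x and c :: real assume "x \<in> ?C" "0 \<le> c"
      then obtain qs where x: "x = cube_vals (\<Sum>q\<leftarrow>qs. q ^ 2)" and qs: "set qs \<subseteq> polys_upto d"
        by blast
      let ?s = "\<lambda>q. const_poly (sqrt c) * q"
      have "cube_vals (?s q ^ 2) = c *\<^sub>R cube_vals (q ^ 2)" for q :: "'a mpoly"
        unfolding power2_eq_square cube_vals_mult[of "?s q" "?s q"] cube_vals_mult[of q q] cube_vals_scale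
        using \<open>0 \<le> c\<close> by simp
      then have "c *\<^sub>R x = cube_vals (\<Sum>q\<leftarrow>map ?s qs. q ^ 2)"
        unfolding x by (simp only: cube_vals_sum_list) (induction qs, auto simp: scaleR_add_right)
      moreover have "set (map ?s qs) \<subseteq> polys_upto d"
        using qs polys_upto_mult[OF polys_upto_const[of "sqrt c" 0]] by fastforce
      ultimately show "c *\<^sub>R x \<in> ?C" by blast
    qed
  qed
  with assms that show ?thesis by blast
qed

lemma vertex_idempotent: "(vertex S $ i)\<^sup>2 = vertex S $ i"
  by (simp add: vertex_def)

text \<open>This moves the whole problem to the finitely many vertices. From values to certificates, the
  difference between \<open>p\<close> and a sum of squares with the same values is reduced modulo the cube; its
  multilinear remainder vanishes on all vertices and hence is zero. Conversely, \<open>\<sigma>\<^sub>0\<close> bounds only the degree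
  of the sum, and \<open>sum_squares_degree\<close> bounds the squared polynomials.\<close>

lemma cube_certificate_iff:
  assumes "d \<ge> 1"
  shows "(\<exists>\<sigma>0 \<sigma>. cube_certificate d p \<sigma>0 \<sigma>) \<longleftrightarrow> p \<in> polys_upto (2 * d) \<and> cube_vals p \<in> cube_sos d"
proof
  assume "\<exists>\<sigma>0 \<sigma>. cube_certificate d p \<sigma>0 \<sigma>"
  then obtain \<sigma>0 \<sigma> qs where \<sigma>0: "\<sigma>0 \<in> polys_upto (2 * d)" "\<sigma>0 = (\<Sum>q\<leftarrow>qs. q ^ 2)"
    and \<sigma>: "\<And>i. \<sigma> i \<in> polys_upto (2 * d - 2)"
    and p: "p = \<sigma>0 + (\<Sum>i\<in>UNIV. (var_poly i ^ 2 - var_poly i) * \<sigma> i)"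
    by (auto simp: cube_certificate_def sos_upto_def)
  have "(var_poly i ^ 2 - var_poly i) * \<sigma> i \<in> polys_upto (2 * d)" for i
  proof -
    have "var_poly i ^ 2 - var_poly i \<in> polys_upto 2"
      using polys_upto_power[OF polys_upto_var[OF order_refl], of i 2]
      by (intro polys_upto_diff polys_upto_var) simp_all
    moreover have "2 + (2 * d - 2) = 2 * d" using assms by simp
    ultimately show ?thesis using polys_upto_mult[OF _ \<sigma>[of i]] by metis
  qed
  then have "p \<in> polys_upto (2 * d)"
    unfolding p using \<sigma>0(1) by (intro polys_upto_add polys_upto_sum)
  moreover have "cube_vals p = (\<Sum>q\<leftarrow>qs. cube_vals q * cube_vals q)"
  proof -
    have "cube_vals p = cube_vals \<sigma>0"
      by (simp add: p vec_eq_iff cube_vals_nth eval_poly_simps vertex_idempotent)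
    then show ?thesis
      by (simp add: \<sigma>0(2) cube_vals_sum_list power2_eq_square cube_vals_mult)
  qed
  moreover have "q \<in> polys_upto d" if "q \<in> set qs" for q
    using sum_squares_degree[of qs d q] \<sigma>0 that by simp
  ultimately show "p \<in> polys_upto (2 * d) \<and> cube_vals p \<in> cube_sos d"
    by (auto intro!: cube_sos_sum_list square_in_cube_sos)
next
  assume "p \<in> polys_upto (2 * d) \<and> cube_vals p \<in> cube_sos d"
  then have p: "p \<in> polys_upto (2 * d)" and "cube_vals p \<in> cube_sos d" by auto
  then obtain qs where qs: "set qs \<subseteq> polys_upto d" and vals: "cube_vals p = cube_vals (\<Sum>q\<leftarrow>qs. q ^ 2)"
    using cube_sos_explicit by metis
  let ?s = "\<Sum>q\<leftarrow>qs. q ^ 2"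
  have s: "?s \<in> polys_upto (2 * d)"
    using qs by (intro polys_upto_sum_list polys_upto_power) auto
  have "cube_reducible (2 * d) (p - ?s)"
    by (intro cube_reducible polys_upto_diff p s)
  then obtain r \<sigma> where r: "multilinear r" and \<sigma>: "\<forall>i. \<sigma> i \<in> polys_upto (2 * d - 2)"
    and eq: "p - ?s = r + (\<Sum>i\<in>UNIV. (var_poly i ^ 2 - var_poly i) * \<sigma> i)"
    by (auto simp: cube_reducible_def)
  have "cube_vals r = cube_vals (p - ?s)"
    unfolding eq by (simp add: vec_eq_iff cube_vals_nth eval_poly_simps vertex_idempotent)
  also have "\<dots> = 0" by (simp add: cube_vals_diff vals)
  finally have "r = 0"
    using r by (intro multilinear_vanishing) (auto simp: vec_eq_iff cube_vals_nth)
  with eq have "p = ?s + (\<Sum>i\<in>UNIV. (var_poly i ^ 2 - var_poly i) * \<sigma> i)"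
    by (simp add: algebra_simps)
  with s \<sigma> show "\<exists>\<sigma>0 \<sigma>. cube_certificate d p \<sigma>0 \<sigma>"
    unfolding cube_certificate_def sos_upto_def by blast
qed

text \<open>A cone generated by a compact set whose convex hull misses 0 is closed. Normalising the value vectors
  \<open>w\<close> to unit length provides such a set: they form the unit sphere of a subspace, and the entries of \<open>w * w\<close>
  then sum to 1, a property that convex combinations share.\<close>

lemma closed_cube_sos: "closed (cube_sos d :: (real ^ ('n::finite set)) set)"
proof -
  define W where "W = (cube_vals ` polys_upto d :: (real ^ 'n set) set)"
  define K where "K = (\<lambda>w. w * w) ` (W \<inter> sphere 0 1)"
  have "subspace W"
    unfolding subspace_def W_def
  proof (intro conjI ballI allI)
    show "0 \<in> cube_vals ` polys_upto d"
      using polys_upto_zero cube_vals_zero by (metis imageI)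
  next
    fix x y :: "real ^ 'n set" assume "x \<in> cube_vals ` polys_upto d" "y \<in> cube_vals ` polys_upto d"
    then show "x + y \<in> cube_vals ` polys_upto d"
      using polys_upto_add by (auto simp flip: cube_vals_add intro!: imageI)
  next
    fix c and x :: "real ^ 'n set" assume "x \<in> cube_vals ` polys_upto d"
    then show "c *\<^sub>R x \<in> cube_vals ` polys_upto d"
      using polys_upto_mult[OF polys_upto_const[of c 0]] by (auto simp flip: cube_vals_scale intro!: imageI)
  qed
  then have "compact (W \<inter> sphere 0 1)"
    by (intro closed_Int_compact closed_subspace compact_sphere)
  moreover have "continuous_on (W \<inter> sphere 0 1) (\<lambda>w. w * w)"
  proof -
    have "(\<lambda>w :: real ^ 'n set. w * w) = (\<lambda>w. \<chi> S. w $ S * w $ S)" by (simp add: fun_eq_iff vec_eq_iff)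
    then show ?thesis by (simp only:) (intro continuous_intros)
  qed
  ultimately have "compact K"
    unfolding K_def by (intro compact_continuous_image)
  then have "compact (convex hull K)"
    by (rule compact_convex_hull)
  moreover have "convex hull K \<subseteq> {z. (\<Sum>S\<in>UNIV. z $ S) = 1}"
  proof (rule hull_minimal)
    show "K \<subseteq> {z. (\<Sum>S\<in>UNIV. z $ S) = 1}"
      by (auto simp: K_def norm_eq_1 inner_vec_def)
    show "convex {z :: real ^ 'n set. (\<Sum>S\<in>UNIV. z $ S) = 1}"
      by (auto simp: convex_def sum.distrib simp flip: sum_distrib_left)
  qed
  then have "0 \<notin> convex hull K" by auto
  ultimately have closed: "closed (conic hull (convex hull K))"
    by (intro closed_conic_hull) auto
  have "cube_sos d = convex_cone hull K"
  proof
    show "cube_sos d \<subseteq> convex_cone hull K"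
      unfolding cube_sos_def
    proof (rule hull_minimal)
      show "(\<lambda>q. cube_vals q * cube_vals q) ` polys_upto d \<subseteq> convex_cone hull K"
      proof clarify
        fix q :: "'n mpoly" assume "q \<in> polys_upto d"
        define w where "w = cube_vals q"
        have w: "w \<in> W" using \<open>q \<in> polys_upto d\<close> by (auto simp: w_def W_def)
        show "cube_vals q * cube_vals q \<in> convex_cone hull K"
        proof (cases "w = 0")
          case True
          then show ?thesis by (simp add: convex_cone_hull_contains_0 flip: w_def)
        next
          case False
          let ?u = "inverse (norm w) *\<^sub>R w"
          have "?u \<in> W \<inter> sphere 0 1"
            using w False \<open>subspace W\<close> by (auto simp: subspace_scale)
          then have "?u * ?u \<in> K"
            unfolding K_def by (rule imageI)
          then have "(norm w)\<^sup>2 *\<^sub>R (?u * ?u) \<in> convex_cone hull K"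
            by (intro convex_cone_hull_mul hull_inc) auto
          moreover have "(norm w)\<^sup>2 *\<^sub>R (?u * ?u) = w * w"
          proof -
            have "(norm w)\<^sup>2 * (inverse (norm w) * inverse (norm w)) = 1"
              using False by (simp add: power2_eq_square field_simps)
            then show ?thesis
              by (simp only: mult_scaleR_left mult_scaleR_right scaleR_scaleR scaleR_one mult.assoc)
          qed
          ultimately show ?thesis by (simp flip: w_def)
        qed
      qed
    qed (rule convex_cone_convex_cone_hull)
    show "convex_cone hull K \<subseteq> cube_sos d"
      unfolding cube_sos_def by (intro hull_mono) (auto simp: K_def W_def)
  qed
  moreover have "K \<noteq> {}"
  proof -
    have "(1 :: real ^ 'n set) \<in> W"
      unfolding W_def using polys_upto_one cube_vals_one by (metis imageI)
    moreover have "(1 :: real ^ 'n set) \<noteq> 0" by simp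
    ultimately have "inverse (norm (1 :: real ^ 'n set)) *\<^sub>R 1 \<in> W \<inter> sphere 0 1"
      using \<open>subspace W\<close> by (auto simp: subspace_scale)
    then show ?thesis by (auto simp: K_def)
  qed
  ultimately show ?thesis
    using closed by (simp add: convex_cone_hull_separate_nonempty)
qed

section \<open>Replacing a perturbation by a linear one\<close>

text \<open>On the cube, \<open>v\<close> and \<open>m\<close> take the values 0 and 1, and \<open>m\<close> vanishes where \<open>v\<close> does. Then \<open>v + m\<close> equals
  \<open>v\<^sup>2 + m\<^sup>2\<close> and \<open>v - m\<close> equals \<open>(v - m)\<^sup>2\<close>.\<close>

lemma cube_sos_idempotent_pair:
  assumes v: "v \<in> polys_upto d" "cube_vals v * cube_vals v = cube_vals v"
    and m: "m \<in> polys_upto d" "cube_vals m * cube_vals m = cube_vals m"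
    and vm: "cube_vals v * cube_vals m = cube_vals m"
  shows "c *\<^sub>R cube_vals m + \<bar>c\<bar> *\<^sub>R cube_vals v \<in> cube_sos d"
proof (cases "c \<ge> 0")
  case True
  have "cube_vals m + cube_vals v \<in> cube_sos d"
    using cube_sos_add[OF square_in_cube_sos[OF m(1)] square_in_cube_sos[OF v(1)]] by (simp add: m v)
  from cube_sos_scale[OF this True] show ?thesis
    using True by (simp add: scaleR_add_right)
next
  case False
  have "cube_vals (v - m) * cube_vals (v - m) = cube_vals v - cube_vals m"
    by (simp add: cube_vals_diff left_diff_distrib right_diff_distrib v m vm
        mult.commute[of "cube_vals m" "cube_vals v"])
  then have "cube_vals v - cube_vals m \<in> cube_sos d"
    using square_in_cube_sos[OF polys_upto_diff[OF v(1) m(1)]] by simp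
  from cube_sos_scale[OF this, of "- c"] show ?thesis
    using False by (simp add: scaleR_diff_right)
qed

lemma poly_l1_norm_superset:
  assumes "finite A" "Poly_Mapping.keys p \<subseteq> A"
  shows "poly_l1_norm p = (\<Sum>\<alpha>\<in>A. \<bar>Poly_Mapping.lookup p \<alpha>\<bar>)"
  unfolding poly_l1_norm_def
  by (rule sum.mono_neutral_left) (use assms in \<open>auto simp: in_keys_iff\<close>)

lemma poly_l1_norm_uminus: "poly_l1_norm (- p) = poly_l1_norm p"
proof -
  have "Poly_Mapping.keys (- p) = Poly_Mapping.keys p" by (auto simp: in_keys_iff)
  then show ?thesis by (simp add: poly_l1_norm_def)
qed

lemma poly_l1_norm_translate_linear_form:
  "poly_l1_norm (translate y (linear_form_at y b)) = (\<Sum>i\<in>UNIV. \<bar>b $ i\<bar>)"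
proof -
  let ?e = "\<lambda>i. Poly_Mapping.single i (1::nat)"
  have eq: "translate y (linear_form_at y b) = (\<Sum>i\<in>UNIV. Poly_Mapping.single (?e i) (b $ i))"
    unfolding linear_form_at_def
    by (simp add: translate_simps) (simp add: const_poly_def var_poly_def mult_single)
  have inj: "inj ?e"
    by (rule injI) (metis keys_single singleton_inject zero_neq_one)
  have "Poly_Mapping.keys (translate y (linear_form_at y b)) \<subseteq> range ?e"
    unfolding eq using keys_sum[of "\<lambda>i. Poly_Mapping.single (?e i) (b $ i)" UNIV]
    by (force split: if_splits)
  then have "poly_l1_norm (translate y (linear_form_at y b)) =
      (\<Sum>\<alpha>\<in>range ?e. \<bar>Poly_Mapping.lookup (translate y (linear_form_at y b)) \<alpha>\<bar>)"
    by (intro poly_l1_norm_superset) auto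
  also have "\<dots> = (\<Sum>i\<in>UNIV. \<bar>Poly_Mapping.lookup (translate y (linear_form_at y b)) (?e i)\<bar>)"
    unfolding sum.reindex[OF inj] by (simp only: o_def)
  also have "\<dots> = (\<Sum>i\<in>UNIV. \<bar>b $ i\<bar>)"
    using inj by (simp add: eq lookup_sum lookup_single when_def inj_eq[OF inj, simplified])
  finally show ?thesis .
qed

lemma inverse_objective_linear:
  "inverse_objective f y (f + linear_form_at y b) = (\<Sum>i\<in>UNIV. \<bar>b $ i\<bar>)"
  by (simp add: inverse_objective_def translate_simps poly_l1_norm_uminus poly_l1_norm_translate_linear_form)

text \<open>At a vertex \<open>y\<close> this is 1 where \<open>y\<^sub>i = 0\<close> and \<open>-1\<close> where \<open>y\<^sub>i = 1\<close>, which makes \<open>v\<^sub>i = \<plusminus>(x\<^sub>i - y\<^sub>i)\<close>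
  equal to \<open>x\<^sub>i\<close> or \<open>1 - x\<^sub>i\<close>.\<close>

definition shift_sign :: "real ^ 'n \<Rightarrow> 'n \<Rightarrow> real"
  where "shift_sign y i = 1 - 2 * y $ i"

definition flipped_var :: "real ^ 'n \<Rightarrow> 'n \<Rightarrow> ('n::finite) mpoly"
  where "flipped_var y i = const_poly (shift_sign y i) * (var_poly i - const_poly (y $ i))"

lemma shift_sign_square: "y \<in> hypercube \<Longrightarrow> shift_sign y i * shift_sign y i = 1"
  by (auto simp: hypercube_def shift_sign_def dest: spec[of _ i])

lemma polys_upto_flipped_var: "1 \<le> t \<Longrightarrow> flipped_var y i \<in> polys_upto t"
  unfolding flipped_var_def
  using polys_upto_mult[OF polys_upto_const[of _ 0] polys_upto_diff[OF polys_upto_var polys_upto_const], of t]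
  by simp

lemma eval_flipped_var: "eval_poly (flipped_var y i) x = shift_sign y i * (x $ i - y $ i)"
  by (simp add: flipped_var_def eval_poly_simps)

lemma eval_flipped_var_vertex:
  assumes "y \<in> hypercube"
  shows "eval_poly (flipped_var y i) (vertex S) \<in> {0, 1}"
proof -
  have "y $ i = 0 \<or> y $ i = 1" using assms by (simp add: hypercube_def)
  then show ?thesis by (auto simp: eval_flipped_var shift_sign_def vertex_def)
qed

text \<open>Expanding \<open>h\<close> around \<open>y\<close> and passing from \<open>x - y\<close> to the flipped variables changes only the signs of
  the coefficients, so the \<open>\<ell>\<^sub>1\<close>-norm in \<open>u = x - y\<close> is kept. Subtracting \<open>h(y)\<close> removes the constant term.\<close>

lemma eval_diff_flipped_expansion:
  fixes h :: "('n::finite) mpoly"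
  assumes "y \<in> hypercube"
  shows "eval_poly h x - eval_poly h y =
    (\<Sum>\<alpha>\<in>Poly_Mapping.keys (translate y h) - {0}.
      Poly_Mapping.lookup (translate y h) \<alpha> * (\<Prod>i\<in>UNIV. shift_sign y i ^ Poly_Mapping.lookup \<alpha> i) *
      (\<Prod>i\<in>UNIV. eval_poly (flipped_var y i) x ^ Poly_Mapping.lookup \<alpha> i))"
proof -
  let ?h = "translate y h"
  let ?m = "\<lambda>(u :: real ^ 'n) \<alpha>. \<Prod>i\<in>UNIV. (u $ i) ^ Poly_Mapping.lookup \<alpha> i"
  have m0: "?m 0 \<alpha> = 0" if "\<alpha> \<noteq> 0" for \<alpha> :: "'n \<Rightarrow>\<^sub>0 nat"
  proof -
    have "\<exists>i. Poly_Mapping.lookup \<alpha> i \<noteq> 0"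
      using that by (metis lookup_zero poly_mapping_eqI)
    then show ?thesis by auto
  qed
  have flip: "?m (x - y) \<alpha> = (\<Prod>i\<in>UNIV. shift_sign y i ^ Poly_Mapping.lookup \<alpha> i) *
      (\<Prod>i\<in>UNIV. eval_poly (flipped_var y i) x ^ Poly_Mapping.lookup \<alpha> i)" for \<alpha>
  proof -
    have undo: "shift_sign y i * (shift_sign y i * (x $ i - y $ i)) = x $ i - y $ i" for i
      by (simp only: mult.assoc[symmetric] shift_sign_square[OF assms] mult_1)
    then show ?thesis
      unfolding prod.distrib[symmetric] power_mult_distrib[symmetric] eval_flipped_var
      by (simp only: undo vector_minus_component)
  qed
  have "eval_poly h x - eval_poly h y = eval_poly ?h (x - y) - eval_poly ?h 0"
    by (simp add: eval_translate)
  also have "\<dots> = (\<Sum>\<alpha>\<in>Poly_Mapping.keys ?h. Poly_Mapping.lookup ?h \<alpha> * (?m (x - y) \<alpha> - ?m 0 \<alpha>))"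
    by (simp add: eval_poly_def right_diff_distrib sum_subtractf)
  also have "\<dots> = (\<Sum>\<alpha>\<in>Poly_Mapping.keys ?h - {0}. Poly_Mapping.lookup ?h \<alpha> * (?m (x - y) \<alpha> - ?m 0 \<alpha>))"
    by (rule sum.mono_neutral_right) auto
  also have "\<dots> = (\<Sum>\<alpha>\<in>Poly_Mapping.keys ?h - {0}. Poly_Mapping.lookup ?h \<alpha> * ?m (x - y) \<alpha>)"
    by (rule sum.cong) (simp_all add: m0 del: zero_index)
  finally show ?thesis
    by (simp only: flip mult.assoc)
qed

lemma cube_sos_flipped_monomial:
  assumes y: "y \<in> hypercube" and i: "Poly_Mapping.lookup \<alpha> i \<noteq> 0" and deg: "mdeg \<alpha> \<le> d"
  shows "c *\<^sub>R cube_vals (\<Prod>j\<in>UNIV. flipped_var y j ^ Poly_Mapping.lookup \<alpha> j) +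
      \<bar>c\<bar> *\<^sub>R cube_vals (flipped_var y i) \<in> cube_sos d"
proof -
  let ?v = "flipped_var y" and ?m = "\<Prod>j\<in>UNIV. flipped_var y j ^ Poly_Mapping.lookup \<alpha> j"
  have "Poly_Mapping.lookup \<alpha> i \<le> mdeg \<alpha>"
    unfolding mdeg_def by (rule member_le_sum) auto
  with i deg have "1 \<le> d" by linarith
  then have v: "?v i \<in> polys_upto d" by (rule polys_upto_flipped_var)
  have m: "?m \<in> polys_upto d"
    using polys_upto_monomial_subst[of "?v" \<alpha>] polys_upto_flipped_var[OF order_refl] polys_upto_mono[OF _ deg] by blast
  have m_vals: "eval_poly ?m (vertex S) \<in> {0, 1}" for S
  proof -
    have factor: "eval_poly (?v j) (vertex S) ^ Poly_Mapping.lookup \<alpha> j \<in> {0, 1}" for j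
      using eval_flipped_var_vertex[OF y, of j S] by (cases "Poly_Mapping.lookup \<alpha> j = 0") (auto simp: power_0_left)
    have "(\<Prod>j\<in>A. w j) \<in> {0, 1}" if "\<And>j. w j \<in> {0, 1}" for A and w :: "'a \<Rightarrow> real"
    proof (induction A rule: infinite_finite_induct)
      case (insert j A)
      then show ?case using that[of j] by auto
    qed auto
    from this[of "\<lambda>j. eval_poly (?v j) (vertex S) ^ Poly_Mapping.lookup \<alpha> j" UNIV, OF factor] show ?thesis by (simp add: eval_poly_simps)
  qed
  have vm_vals: "eval_poly ?m (vertex S) = 0" if "eval_poly (?v i) (vertex S) = 0" for S
    using that i by (auto simp: eval_poly_simps prod_zero_iff)
  show ?thesis
  proof (rule cube_sos_idempotent_pair[OF v _ m])
    show "cube_vals (?v i) * cube_vals (?v i) = cube_vals (?v i)"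
      using eval_flipped_var_vertex[OF y, of i] by (simp add: vec_eq_iff cube_vals_nth)
    show "cube_vals ?m * cube_vals ?m = cube_vals ?m"
      using m_vals by (simp add: vec_eq_iff cube_vals_nth)
    show "cube_vals (?v i) * cube_vals ?m = cube_vals ?m"
      unfolding vec_eq_iff
    proof
      fix S
      consider "eval_poly (?v i) (vertex S) = 0" | "eval_poly (?v i) (vertex S) = 1"
        using eval_flipped_var_vertex[OF y, of i S] by blast
      then show "(cube_vals (?v i) * cube_vals ?m) $ S = cube_vals ?m $ S"
        by cases (simp_all only: vector_mult_component cube_vals_nth vm_vals mult_1 mult_zero_left)
    qed
  qed
qed

text \<open>Each nonconstant monomial of \<open>f - g\<close> is charged to one variable that occurs in it, at the price of
  the absolute value of its coefficient. The total charge of \<open>x\<^sub>i\<close> becomes \<open>\<bar>b\<^sub>i\<bar>\<close>, so the cost of the linear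
  form is that of \<open>f - g\<close> without its constant term.\<close>

lemma linear_dominates_perturbation:
  fixes f g :: "('n::finite) mpoly"
  assumes y: "y \<in> hypercube" and f: "f \<in> polys_upto d" and g: "g \<in> polys_upto d"
    and g_sos: "cube_vals (g - const_poly (eval_poly g y)) \<in> cube_sos d"
  obtains b where "sign_pattern y b"
    "cube_vals (f - const_poly (eval_poly f y) + linear_form_at y b) \<in> cube_sos d"
    "(\<Sum>i\<in>UNIV. \<bar>b $ i\<bar>) \<le> inverse_objective f y g"
proof -
  define h' where "h' = translate y (f - g)"
  define A where "A = Poly_Mapping.keys h' - {0}"
  define c where "c \<alpha> = Poly_Mapping.lookup h' \<alpha> * (\<Prod>i\<in>UNIV. shift_sign y i ^ Poly_Mapping.lookup \<alpha> i)" for \<alpha>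
  define \<iota> where "\<iota> \<alpha> = (SOME i. Poly_Mapping.lookup \<alpha> i \<noteq> 0)" for \<alpha> :: "'n \<Rightarrow>\<^sub>0 nat"
  \<comment> \<open>total charge of the variable \<open>i\<close>; the factor \<open>shift_sign y i\<close> in \<open>b\<close> turns \<open>x\<^sub>i - y\<^sub>i\<close> into \<open>v\<^sub>i\<close>\<close>
  define B where "B i = (\<Sum>\<alpha> | \<alpha> \<in> A \<and> \<iota> \<alpha> = i. \<bar>c \<alpha>\<bar>)" for i
  define b :: "real ^ 'n" where "b = (\<chi> i. shift_sign y i * B i)"
  have finA: "finite A" by (simp add: A_def)
  have \<iota>: "Poly_Mapping.lookup \<alpha> (\<iota> \<alpha>) \<noteq> 0" if "\<alpha> \<in> A" for \<alpha>
  proof -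
    have "\<exists>i. Poly_Mapping.lookup \<alpha> i \<noteq> 0" using that by (metis A_def DiffE lookup_zero poly_mapping_eqI singletonI)
    then show ?thesis unfolding \<iota>_def by (rule someI_ex)
  qed
  have deg: "mdeg \<alpha> \<le> d" if "\<alpha> \<in> A" for \<alpha>
    using polys_upto_translate[OF polys_upto_diff[OF f g], of y] that
    by (auto simp: A_def h'_def polys_upto_iff)
  have y01: "y $ i = 0 \<or> y $ i = 1" for i using y by (simp add: hypercube_def)
  have abs_sign: "\<bar>shift_sign y i\<bar> = 1" for i
    using y01[of i] by (auto simp: shift_sign_def)
  have abs_c: "\<bar>c \<alpha>\<bar> = \<bar>Poly_Mapping.lookup h' \<alpha>\<bar>" for \<alpha>
    by (simp add: c_def abs_mult abs_prod power_abs abs_sign)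
  have B: "B i \<ge> 0" for i by (simp add: B_def sum_nonneg)
  \<comment> \<open>a sum over variables weighted by charges is a sum over the charged monomials\<close>
  have regroup: "(\<Sum>i\<in>UNIV. B i * w i) = (\<Sum>\<alpha>\<in>A. \<bar>c \<alpha>\<bar> * w (\<iota> \<alpha>))" for w :: "'n \<Rightarrow> real"
  proof -
    have "(\<Sum>i\<in>UNIV. B i * w i) = (\<Sum>i\<in>UNIV. \<Sum>\<alpha> | \<alpha> \<in> A \<and> \<iota> \<alpha> = i. \<bar>c \<alpha>\<bar> * w (\<iota> \<alpha>))"
      by (auto simp: B_def sum_distrib_right intro!: sum.cong)
    also have "\<dots> = (\<Sum>\<alpha>\<in>A. \<bar>c \<alpha>\<bar> * w (\<iota> \<alpha>))"
      using finA by (intro sum.group) auto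
    finally show ?thesis .
  qed
  show thesis
  proof (rule that)
    show "sign_pattern y b"
      using B by (auto simp: sign_pattern_def b_def shift_sign_def)
    have "(\<Sum>i\<in>UNIV. \<bar>b $ i\<bar>) = (\<Sum>i\<in>UNIV. B i * 1)"
      using B by (simp add: b_def abs_mult abs_sign)
    also have "\<dots> = (\<Sum>\<alpha>\<in>A. \<bar>Poly_Mapping.lookup h' \<alpha>\<bar>)"
      unfolding regroup by (simp add: abs_c)
    also have "\<dots> \<le> poly_l1_norm h'"
      unfolding poly_l1_norm_def A_def by (intro sum_mono2) auto
    also have "\<dots> = inverse_objective f y g"
      by (simp add: inverse_objective_def h'_def translate_simps)
    finally show "(\<Sum>i\<in>UNIV. \<bar>b $ i\<bar>) \<le> inverse_objective f y g" .
    let ?m = "\<lambda>\<alpha>. \<Prod>j\<in>UNIV. flipped_var y j ^ Poly_Mapping.lookup \<alpha> j"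
    have "cube_vals (f - const_poly (eval_poly f y) + linear_form_at y b) =
        cube_vals (g - const_poly (eval_poly g y)) +
        (\<Sum>\<alpha>\<in>A. c \<alpha> *\<^sub>R cube_vals (?m \<alpha>) + \<bar>c \<alpha>\<bar> *\<^sub>R cube_vals (flipped_var y (\<iota> \<alpha>)))"
      unfolding vec_eq_iff
    proof
      fix S
      let ?x = "vertex S :: real ^ 'n"
      have lin: "eval_poly (linear_form_at y b) ?x = (\<Sum>\<alpha>\<in>A. \<bar>c \<alpha>\<bar> * eval_poly (flipped_var y (\<iota> \<alpha>)) ?x)"
      proof -
        have "eval_poly (linear_form_at y b) ?x = (\<Sum>i\<in>UNIV. B i * eval_poly (flipped_var y i) ?x)"
          unfolding eval_linear_form by (simp add: b_def eval_flipped_var mult_ac)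
        then show ?thesis by (simp only: regroup)
      qed
      have "eval_poly (f - g) ?x - eval_poly (f - g) y = (\<Sum>\<alpha>\<in>A. c \<alpha> * eval_poly (?m \<alpha>) ?x)"
        unfolding eval_diff_flipped_expansion[OF y] A_def c_def h'_def by (simp add: eval_poly_simps)
      then show "cube_vals (f - const_poly (eval_poly f y) + linear_form_at y b) $ S =
          (cube_vals (g - const_poly (eval_poly g y)) +
          (\<Sum>\<alpha>\<in>A. c \<alpha> *\<^sub>R cube_vals (?m \<alpha>) + \<bar>c \<alpha>\<bar> *\<^sub>R cube_vals (flipped_var y (\<iota> \<alpha>)))) $ S"
        using lin by (simp add: cube_vals_nth eval_poly_simps sum.distrib)
    qed
    then show "cube_vals (f - const_poly (eval_poly f y) + linear_form_at y b) \<in> cube_sos d"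
      using g_sos \<iota> deg by (simp only:) (intro cube_sos_add cube_sos_sum cube_sos_flipped_monomial[OF y], auto)
  qed
qed

section \<open>Existence of an optimal linear perturbation\<close>

text \<open>The \<open>b\<close>-components of the feasible points of the semidefinite program, described on the vertices; see
  \<open>linear_certified_iff\<close>.\<close>

definition linear_certified :: "nat \<Rightarrow> ('n::finite) mpoly \<Rightarrow> real ^ 'n \<Rightarrow> (real ^ 'n) set"
  where "linear_certified d f y = {b. sign_pattern y b \<and>
    cube_vals (f - const_poly (eval_poly f y) + linear_form_at y b) \<in> cube_sos d}"

lemma closed_linear_certified: "closed (linear_certified d f y)"
proof -
  have "closed {b. sign_pattern y b}"
    unfolding sign_pattern_def
    by (intro closed_Collect_all closed_Collect_conj closed_Collect_imp open_Collect_const closed_Collect_le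
        continuous_intros)
  moreover have "closed ((\<lambda>b. cube_vals (f - const_poly (eval_poly f y) + linear_form_at y b)) -` cube_sos d)"
  proof (rule closed_vimage[OF closed_cube_sos])
    show "continuous_on UNIV (\<lambda>b. cube_vals (f - const_poly (eval_poly f y) + linear_form_at y b))"
      by (auto simp: cube_vals_def eval_poly_simps eval_linear_form intro!: continuous_intros)
  qed
  moreover have "linear_certified d f y = {b. sign_pattern y b} \<inter>
      (\<lambda>b. cube_vals (f - const_poly (eval_poly f y) + linear_form_at y b)) -` cube_sos d"
    by (auto simp: linear_certified_def)
  ultimately show ?thesis by (simp add: closed_Int)
qed

text \<open>The sublevel sets of the \<open>\<ell>\<^sub>1\<close>-norm are compact, so the search can be confined to one of them.\<close>

lemma closed_attains_min_l1:
  fixes F :: "(real ^ 'n) set"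
  assumes "closed F" "F \<noteq> {}"
  obtains b where "b \<in> F" "\<And>b'. b' \<in> F \<Longrightarrow> (\<Sum>i\<in>UNIV. \<bar>b $ i\<bar>) \<le> (\<Sum>i\<in>UNIV. \<bar>b' $ i\<bar>)"
proof -
  let ?N = "\<lambda>b :: real ^ 'n. \<Sum>i\<in>UNIV. \<bar>b $ i\<bar>"
  obtain b0 where b0: "b0 \<in> F" using assms by blast
  let ?K = "F \<inter> {b. ?N b \<le> ?N b0}"
  have "?K \<subseteq> cball 0 (?N b0)"
    using norm_le_l1_cart by (fastforce intro: order_trans)
  moreover have "closed {b. ?N b \<le> ?N b0}"
    by (intro closed_Collect_le continuous_intros)
  ultimately have "compact ?K"
    using assms by (metis bounded_cball bounded_subset closed_Int compact_eq_bounded_closed)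
  moreover have "continuous_on ?K ?N" by (intro continuous_intros)
  ultimately obtain b where b: "b \<in> ?K" and min: "\<forall>b'\<in>?K. ?N b \<le> ?N b'"
    using b0 continuous_attains_inf[of ?K ?N] by blast
  show thesis
  proof (rule that)
    show "b \<in> F" using b by simp
    show "?N b \<le> ?N b'" if "b' \<in> F" for b'
      using min b that by (cases "?N b' \<le> ?N b0") auto
  qed
qed

lemma linear_certified_iff:
  assumes "d \<ge> 1" "f \<in> polys_upto d"
  shows "b \<in> linear_certified d f y \<longleftrightarrow> (\<exists>\<sigma>0 \<sigma>. sdp_feasible d f y (b, \<sigma>0, \<sigma>))"
proof -
  have "f - const_poly (eval_poly f y) + linear_form_at y b \<in> polys_upto (2 * d)"
    using assms polys_upto_mono[OF assms(2)]
    by (intro polys_upto_add polys_upto_diff polys_upto_const polys_upto_linear_form) auto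
  then show ?thesis
    by (simp add: linear_certified_def sdp_feasible_def cube_certificate_iff[OF assms(1)])
qed

lemma inverse_feasible_linear_iff:
  assumes "sign_pattern y b"
  shows "inverse_feasible d f y (f + linear_form_at y b) \<longleftrightarrow>
    f + linear_form_at y b \<in> polys_upto (total_degree f) \<and> (\<exists>\<sigma>0 \<sigma>. sdp_feasible d f y (b, \<sigma>0, \<sigma>))"
proof -
  have eq: "f + linear_form_at y b - const_poly (eval_poly (f + linear_form_at y b) y) =
      f - const_poly (eval_poly f y) + linear_form_at y b"
    by (simp add: eval_poly_simps eval_linear_form)
  then show ?thesis
    using assms unfolding inverse_feasible_def eq sdp_feasible_def by simp
qed

text \<open>The last conclusion is where the degree bound \<open>deg f\<close> on competitors matters: a linear form fits
  under it unless \<open>f\<close> is constant. In that case \<open>f\<close> itself is feasible at cost 0, so the minimal \<open>b\<close> is 0.\<close>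

lemma linear_minimiser_exists:
  fixes f :: "('n::finite) mpoly"
  assumes d: "d \<ge> 1" and f: "f \<in> polys_upto d" and y: "y \<in> hypercube"
  obtains b where "b \<in> linear_certified d f y"
    "\<And>b'. b' \<in> linear_certified d f y \<Longrightarrow> (\<Sum>i\<in>UNIV. \<bar>b $ i\<bar>) \<le> (\<Sum>i\<in>UNIV. \<bar>b' $ i\<bar>)"
    "\<And>g. inverse_feasible d f y g \<Longrightarrow> (\<Sum>i\<in>UNIV. \<bar>b $ i\<bar>) \<le> inverse_objective f y g"
    "f + linear_form_at y b \<in> polys_upto (total_degree f)"
proof -
  let ?N = "\<lambda>b :: real ^ 'n. \<Sum>i\<in>UNIV. \<bar>b $ i\<bar>"
  have dominated: "\<exists>b \<in> linear_certified d f y. ?N b \<le> inverse_objective f y g" if "inverse_feasible d f y g" for g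
  proof -
    have "g \<in> polys_upto d"
      using that f by (auto simp: inverse_feasible_def polys_upto_def)
    moreover have "cube_vals (g - const_poly (eval_poly g y)) \<in> cube_sos d"
      using that cube_certificate_iff[OF d] by (auto simp: inverse_feasible_def)
    ultimately obtain b where "sign_pattern y b"
      "cube_vals (f - const_poly (eval_poly f y) + linear_form_at y b) \<in> cube_sos d"
      "?N b \<le> inverse_objective f y g"
      using linear_dominates_perturbation[OF y f] by blast
    then show ?thesis
      by (intro bexI[of _ b]) (simp_all add: linear_certified_def)
  qed
  have trivial: "\<exists>\<sigma>0 \<sigma>. cube_certificate d (0 :: 'n mpoly) \<sigma>0 \<sigma>"
    unfolding cube_certificate_iff[OF d] by (simp add: polys_upto_zero cube_vals_zero cube_sos_zero)
  \<comment> \<open>the zero polynomial shows that the inverse problem, and hence the set of \<open>b\<close>, is nonempty\<close>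
  then have "inverse_feasible d f y 0"
    by (simp add: inverse_feasible_def polys_upto_zero eval_poly_simps const_poly_def)
  then have "linear_certified d f y \<noteq> {}" using dominated by blast
  then obtain b where b: "b \<in> linear_certified d f y"
    and min: "\<And>b'. b' \<in> linear_certified d f y \<Longrightarrow> ?N b \<le> ?N b'"
    using closed_attains_min_l1[OF closed_linear_certified] by blast
  show thesis
  proof (rule that[OF b min])
    show "?N b \<le> inverse_objective f y g" if "inverse_feasible d f y g" for g
      using dominated[OF that] min by (blast intro: order_trans)
    show "f + linear_form_at y b \<in> polys_upto (total_degree f)"
    proof (cases "total_degree f = 0")
      case False
      then show ?thesis
        by (intro polys_upto_add polys_upto_total_degree polys_upto_linear_form) simp
    next
      case True
      have zero: "linear_form_at y 0 = 0" by (simp add: linear_form_at_def const_poly_def)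
      have "inverse_feasible d f y f"
      proof -
        have "Poly_Mapping.keys f \<subseteq> {0}"
        proof
          fix \<alpha> assume "\<alpha> \<in> Poly_Mapping.keys f"
          then have "mdeg \<alpha> \<le> 0"
            using polys_upto_total_degree[of f] True unfolding polys_upto_iff by metis
          then show "\<alpha> \<in> {0}" by (auto simp: mdeg_def intro: poly_mapping_eqI)
        qed
        then have f_const: "f = const_poly (Poly_Mapping.lookup f 0)"
          unfolding const_poly_def by (intro poly_mapping_eqI) (auto simp: lookup_single when_def in_keys_iff)
        have "f - const_poly (eval_poly f y) = 0"
          by (subst (1 2) f_const) (simp add: eval_poly_simps)
        then show ?thesis
          using trivial by (simp add: inverse_feasible_def polys_upto_total_degree)
      qed
      from dominated[OF this] obtain b' where "b' \<in> linear_certified d f y" "?N b' \<le> inverse_objective f y f"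
        by blast
      moreover have "inverse_objective f y f = 0"
        by (simp add: inverse_objective_def poly_l1_norm_def)
      ultimately have "?N b \<le> 0" using min[of b'] by linarith
      then have "?N b = 0" by (intro antisym sum_nonneg) auto
      then have "b = 0" by (simp add: vec_eq_iff sum_nonneg_eq_0_iff)
      then show ?thesis by (simp add: zero polys_upto_total_degree)
    qed
  qed
qed

lemma sdp_objective_l1:
  assumes "y \<in> hypercube" "sign_pattern y b"
  shows "sdp_objective y (b, \<sigma>0, \<sigma>) = (\<Sum>i\<in>UNIV. \<bar>b $ i\<bar>)"
proof -
  have y01: "y $ i = 0 \<or> y $ i = 1" for i using assms by (simp add: hypercube_def)
  have "(\<Sum>i\<in>UNIV. \<bar>b $ i\<bar>) = (\<Sum>i\<in>UNIV. (if y $ i = 0 then b $ i else 0) - (if y $ i = 1 then b $ i else 0))"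
  proof (rule sum.cong[OF refl])
    fix i
    show "\<bar>b $ i\<bar> = (if y $ i = 0 then b $ i else 0) - (if y $ i = 1 then b $ i else 0)"
      using y01[of i] assms(2) by (auto simp: sign_pattern_def)
  qed
  also have "\<dots> = (\<Sum>i | y $ i = 0. b $ i) - (\<Sum>i | y $ i = 1. b $ i)"
    by (simp add: sum_subtractf sum.If_cases)
  finally show ?thesis by (simp add: sdp_objective_def)
qed

theorem corollary3p5:
  fixes f :: "('n::finite) mpoly" and y :: "real ^ 'n" and d :: nat
  assumes "d \<ge> 1"
    and "f \<in> polys_upto d"
    and "y \<in> hypercube"
  shows "(\<exists>b. sign_pattern y b \<and> inverse_optimal d f y (f + linear_form_at y b))
    \<and> (\<forall>b. sign_pattern y b \<and> inverse_optimal d f y (f + linear_form_at y b) \<longrightarrow>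
          (\<exists>\<sigma>0 \<sigma>. sdp_optimal d f y (b, \<sigma>0, \<sigma>)))
    \<and> (\<forall>b \<sigma>0 \<sigma>. sdp_feasible d f y (b, \<sigma>0, \<sigma>) \<longrightarrow>
          sdp_objective y (b, \<sigma>0, \<sigma>) = (\<Sum>i\<in>UNIV. \<bar>b $ i\<bar>))"
proof -
  obtain c where c: "c \<in> linear_certified d f y"
    and c_min: "\<And>b. b \<in> linear_certified d f y \<Longrightarrow> (\<Sum>i\<in>UNIV. \<bar>c $ i\<bar>) \<le> (\<Sum>i\<in>UNIV. \<bar>b $ i\<bar>)"
    and c_opt: "\<And>g. inverse_feasible d f y g \<Longrightarrow> (\<Sum>i\<in>UNIV. \<bar>c $ i\<bar>) \<le> inverse_objective f y g"
    and c_deg: "f + linear_form_at y c \<in> polys_upto (total_degree f)"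
    using linear_minimiser_exists[OF assms] by blast
  have objective: "sdp_objective y (b, \<sigma>0, \<sigma>) = (\<Sum>i\<in>UNIV. \<bar>b $ i\<bar>)"
    if "sdp_feasible d f y (b, \<sigma>0, \<sigma>)" for b \<sigma>0 \<sigma>
    using that sdp_objective_l1[OF assms(3)] by (simp add: sdp_feasible_def)
  have c_sign: "sign_pattern y c" using c by (simp add: linear_certified_def)
  have c_feasible: "inverse_feasible d f y (f + linear_form_at y c)"
    using c c_deg linear_certified_iff[OF assms(1,2)] inverse_feasible_linear_iff[OF c_sign] by blast
  have "inverse_optimal d f y (f + linear_form_at y c)"
    unfolding inverse_optimal_def is_arg_min_linorder inverse_objective_linear
    using c_feasible c_opt by blast
  moreover have "\<exists>\<sigma>0 \<sigma>. sdp_optimal d f y (b, \<sigma>0, \<sigma>)"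
    if b: "sign_pattern y b" and opt: "inverse_optimal d f y (f + linear_form_at y b)" for b
  proof -
    from opt have "inverse_feasible d f y (f + linear_form_at y b)"
      by (simp add: inverse_optimal_def is_arg_min_def)
    then obtain \<sigma>0 \<sigma> where feas: "sdp_feasible d f y (b, \<sigma>0, \<sigma>)"
      using inverse_feasible_linear_iff[OF b] by blast
    have le: "(\<Sum>i\<in>UNIV. \<bar>b $ i\<bar>) \<le> (\<Sum>i\<in>UNIV. \<bar>c $ i\<bar>)"
      using opt c_feasible
      unfolding inverse_optimal_def is_arg_min_linorder by (metis inverse_objective_linear)
    have "sdp_objective y (b, \<sigma>0, \<sigma>) \<le> sdp_objective y z" if z: "sdp_feasible d f y z" for z
    proof -
      obtain b' \<tau>0 \<tau> where z_eq: "z = (b', \<tau>0, \<tau>)" by (cases z)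
      with z have "b' \<in> linear_certified d f y"
        using linear_certified_iff[OF assms(1,2)] by blast
      from le c_min[OF this] show ?thesis
        using objective[OF feas] objective[of b' \<tau>0 \<tau>] z by (simp add: z_eq)
    qed
    with feas show ?thesis
      unfolding sdp_optimal_def is_arg_min_linorder by blast
  qed
  ultimately show ?thesis
    using c_sign objective by blast
qed

end
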